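(* Let $d$ be an arbitrary design with $\pi_i\in(0,1)$. Consider the direct imputation estimator $\hat c_i$ with $\gamma_i=\hat\theta_{(-i)}$, that is, $\hat c_i=\frac{1-\pi_i}{\pi_i}Y_i^{\text{obs}}-(1-\pi_i)\gamma_i$ if $W_i=1$ and $\hat c_i=\frac{\pi_i}{1-\pi_i}Y_i^{\text{obs}}+\pi_i\gamma_i$ if $W_i=0$, where $$\hat\theta_{(-i)}=\frac1{N-1}\sum_{j\ne i}\frac{W_jY_j^{\text{obs}}(1-\pi_j)}{\tilde\pi_j\pi_j}-\frac1{N-1}\sum_{j\ne i}\frac{(1-W_j)Y_j^{\text{obs}}\pi_j}{(1-\tilde\pi_j)(1-\pi_j)},$$ with $\tilde\pi_j=\Pr_d(W_j=1\mid W_i=1)$ if $W_i=1$ and $\tilde\pi_j=\Pr_d(W_j=1\mid W_i=0)$ if $W_i=0$. Then $$\mathbb{E}_d(\hat\theta_{(-i)}\mid W_i=1)=\mathbb{E}_d(\hat\theta_{(-i)}\mid W_i=0)=\frac1{N-1}\sum_{j\ne i}\left(\frac{1-\pi_j}{\pi_j}Y_j(1)-\frac{\pi_j}{1-\pi_j}Y_j(0)\right),$$ and hence $\mathbb{E}_d(\hat c_i)=c_i$, where $c_i=(1-\pi_i)Y_i(1)+\pi_iY_i(0)$.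
   Context: There are $N$ units with fixed real potential outcomes $Y_i(0),Y_i(1)$. A design $d$ is a probability distribution of the random assignment vector $\bm{W}=(W_1,\dots,W_N)^\top\in\{0,1\}^N$; $\pi_i=\Pr_d(W_i=1)$, and $\pi_i\in(0,1)$ is required for every unit $i\in\{1,\dots,N\}$; $\mathbb{E}_d$ is over $\bm{W}$ only; the observed outcome is $Y_i^{\text{obs}}=W_iY_i(1)+(1-W_i)Y_i(0)$.
   Formalization: The formal theorem adds, for the given i, that Pr(W_j=1 | W_i=w) lies strictly between 0 and 1 for all j≠i and w in {0,1}; otherwise the estimator divides by zero (e.g. N=2, W_2=W_1), so the claim fails for a truly arbitrary design. *)

theory Defs
  imports "HOL-Probability.Probability"
begin

text \<open>
  The \<open>N = CARD('n)\<close> units are the elements of a finite type \<open>'n\<close>.  An assignment is a map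
  \<open>W :: 'n \<Rightarrow> bool\<close>, where \<open>W i\<close> means that unit \<open>i\<close> is treated (\<open>W\<^sub>i = 1\<close>); \<open>of_bool (W i)\<close> is
  the corresponding number in \<open>{0, 1}\<close>.  Potential outcomes are given by fixed functions
  \<open>Y0, Y1 :: 'n \<Rightarrow> real\<close>.  Estimators are functions of the design, the realized assignment and the
  vector \<open>y\<close> of observed outcomes.
\<close>

type_synonym 'n assignment = "'n \<Rightarrow> bool"
type_synonym 'n design = "'n assignment pmf"

definition obs_outcome :: "('n \<Rightarrow> real) \<Rightarrow> ('n \<Rightarrow> real) \<Rightarrow> 'n assignment \<Rightarrow> 'n \<Rightarrow> real" where
  "obs_outcome Y0 Y1 W i = of_bool (W i) * Y1 i + (1 - of_bool (W i)) * Y0 i"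

definition treat_prob :: "'n design \<Rightarrow> 'n \<Rightarrow> real" where
  "treat_prob d i = measure_pmf.prob d {W. W i}"

text \<open>
  The design conditional on \<open>W\<^sub>i = w\<close>.  As usual for \<^const>\<open>cond_pmf\<close>, it is meaningful only if
  this event has positive probability, which holds whenever \<open>0 < treat_prob d i < 1\<close>.
\<close>
definition design_given :: "'n design \<Rightarrow> 'n \<Rightarrow> bool \<Rightarrow> 'n design" where
  "design_given d i w = cond_pmf d {W. W i = w}"

text \<open>
  \<open>treat_prob_given d i w j\<close> is the probability of \<open>W\<^sub>j = 1\<close> given \<open>W\<^sub>i = w\<close>.  The random quantity
  \<open>\<pi>\<close>-tilde of unit \<open>j\<close> is obtained by taking \<open>w = W i\<close>.
\<close>
definition treat_prob_given :: "'n design \<Rightarrow> 'n \<Rightarrow> bool \<Rightarrow> 'n \<Rightarrow> real" where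
  "treat_prob_given d i w j = treat_prob (design_given d i w) j"

text \<open>
  The formula is defined only if \<open>0 < treat_prob_given d i w j < 1\<close> for all \<open>j \<noteq> i\<close> and both \<open>w\<close>;
  otherwise a term \<open>0 / 0\<close> occurs, which is \<open>0\<close> in HOL and makes the estimator biased.
\<close>
definition theta_hat_minus ::
  "'n::finite design \<Rightarrow> 'n \<Rightarrow> 'n assignment \<Rightarrow> ('n \<Rightarrow> real) \<Rightarrow> real" where
  "theta_hat_minus d i W y =
     1 / (real CARD('n) - 1) *
       (\<Sum>j\<in>UNIV - {i}. of_bool (W j) * y j * (1 - treat_prob d j) /
          (treat_prob_given d i (W i) j * treat_prob d j))
   - 1 / (real CARD('n) - 1) *
       (\<Sum>j\<in>UNIV - {i}. (1 - of_bool (W j)) * y j * treat_prob d j /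
          ((1 - treat_prob_given d i (W i) j) * (1 - treat_prob d j)))"

text \<open>The direct imputation estimator with realized value \<open>\<gamma>\<close> of \<open>\<gamma>\<^sub>i\<close>.\<close>
definition imputation_estimator ::
  "'n design \<Rightarrow> real \<Rightarrow> 'n \<Rightarrow> 'n assignment \<Rightarrow> ('n \<Rightarrow> real) \<Rightarrow> real" where
  "imputation_estimator d \<gamma> i W y =
     (if W i
      then (1 - treat_prob d i) / treat_prob d i * y i - (1 - treat_prob d i) * \<gamma>
      else treat_prob d i / (1 - treat_prob d i) * y i + treat_prob d i * \<gamma>)"

end

theory Submission
  imports Defs
begin

text \<open>
  Given \<open>W\<^sub>i = w\<close>, the random denominators of \<open>\<theta>\<close>-hat become the constants
  \<open>Pr (W\<^sub>j = 1 | W\<^sub>i = w)\<close>, which cancel against the conditional expectations of the treatment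
  indicators; hence both conditional means equal the same number \<open>m\<close>.  In the law of total
  expectation for the imputation estimator the contributions \<open>- \<pi>\<^sub>i (1 - \<pi>\<^sub>i) m\<close> of the event
  \<open>W\<^sub>i = 1\<close> and \<open>(1 - \<pi>\<^sub>i) \<pi>\<^sub>i m\<close> of the event \<open>W\<^sub>i = 0\<close> then cancel.
\<close>

text \<open>On \<open>A\<close> the conditional mass is \<open>pmf p x\<close> divided by
  \<open>measure_pmf.prob p A\<close>, and off \<open>A\<close> it is 0. The product form clears
  this division, so it can serve directly as one summand of the law of total expectation.\<close>

lemma expectation_cond_pmf:
  fixes f :: "'a \<Rightarrow> real"
  assumes "finite (set_pmf p)" and ne: "set_pmf p \<inter> A \<noteq> {}"
  shows "measure_pmf.prob p A * measure_pmf.expectation (cond_pmf p A) f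
           = measure_pmf.expectation p (\<lambda>x. indicator A x * f x)"
proof -
  have pos: "measure_pmf.prob p A > 0"
    using ne by (meson disjoint_iff measure_pmf_posI)
  \<comment> \<open>Summing over all of \<open>set_pmf p\<close>, not only over the smaller
    conditional support, makes the two sums comparable term by term.\<close>
  have "measure_pmf.expectation (cond_pmf p A) f
          = (\<Sum>x\<in>set_pmf p. pmf (cond_pmf p A) x * f x)"
    using assms by (subst integral_measure_pmf[where A = "set_pmf p"]) (auto simp: set_cond_pmf)
  moreover have "measure_pmf.expectation p (\<lambda>x. indicator A x * f x)
          = (\<Sum>x\<in>set_pmf p. pmf p x * (indicator A x * f x))"
    using assms by (subst integral_measure_pmf[where A = "set_pmf p"]) auto
  ultimately show ?thesis
    using pos by (auto simp: sum_distrib_left pmf_cond[OF ne] intro!: sum.cong)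
qed

lemma treat_prob_eq_expectation:
  "measure_pmf.expectation d (\<lambda>W. of_bool (W j)) = treat_prob d j"
proof -
  have "(\<lambda>W. of_bool (W j) :: real) = indicator {W. W j}"
    by (auto simp: indicator_def)
  then show ?thesis
    by (simp add: treat_prob_def)
qed

lemma prob_not_treated:
  "measure_pmf.prob d {W. \<not> W i} = 1 - treat_prob d i"
  using measure_pmf.prob_compl[of "{W. W i}" d] by (simp add: treat_prob_def Collect_neg_eq Compl_eq_Diff_UNIV)

text \<open>This makes conditioning meaningful in both arms: the events have probabilities \<pi> and
  1 - \<pi>, both nonzero.\<close>

lemma design_given_nonempty:
  assumes "0 < treat_prob d i" "treat_prob d i < 1"
  shows "set_pmf d \<inter> {W. W i = w} \<noteq> {}"
proof -
  have "measure_pmf.prob d {W. W i = w} \<noteq> 0"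
    using assms prob_not_treated[of d i] by (cases w) (auto simp: treat_prob_def)
  then show ?thesis
    by (simp add: measure_pmf_zero_iff)
qed

lemma set_pmf_design_given:
  assumes "0 < treat_prob d i" "treat_prob d i < 1"
  shows "set_pmf (design_given d i w) = set_pmf d \<inter> {W. W i = w}"
  unfolding design_given_def by (rule set_cond_pmf[OF design_given_nonempty[OF assms]])

text \<open>The two values of \<open>W i\<close> partition the assignments, so \<open>f\<close>
  splits into two indicator parts, to each of which \<open>expectation_cond_pmf\<close> applies.
  Integrability is free because there are finitely many assignments.\<close>

lemma total_expectation_design_given:
  fixes d :: "('n::finite) design" and f :: "'n assignment \<Rightarrow> real"
  assumes "0 < treat_prob d i" "treat_prob d i < 1"
  shows "measure_pmf.expectation d f
           = treat_prob d i * measure_pmf.expectation (design_given d i True) f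
             + (1 - treat_prob d i) * measure_pmf.expectation (design_given d i False) f"
proof -
  have int: "integrable (measure_pmf d) g" for g :: "'n assignment \<Rightarrow> real"
    by (rule integrable_measure_pmf_finite) simp
  have "measure_pmf.expectation d f
      = measure_pmf.expectation d (\<lambda>W. indicator {W. W i = True} W * f W
          + indicator {W. W i = False} W * f W)"
    by (intro arg_cong[where f = "measure_pmf.expectation d"]) (auto simp: indicator_def)
  also have "\<dots> = measure_pmf.expectation d (\<lambda>W. indicator {W. W i = True} W * f W)
      + measure_pmf.expectation d (\<lambda>W. indicator {W. W i = False} W * f W)"
    by (rule Bochner_Integration.integral_add[OF int int])
  also have "\<dots> = measure_pmf.prob d {W. W i = True} * measure_pmf.expectation (design_given d i True) f
      + measure_pmf.prob d {W. W i = False} * measure_pmf.expectation (design_given d i False) f"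
    unfolding design_given_def
    by (simp only: expectation_cond_pmf[OF finite design_given_nonempty[OF assms]])
  finally show ?thesis
    using prob_not_treated[of d i] by (simp add: treat_prob_def)
qed

lemma expectation_theta_hat_minus:
  fixes d :: "('n::finite) design"
  assumes \<pi>: "\<And>j. 0 < treat_prob d j \<and> treat_prob d j < 1"
    and given: "\<And>j. j \<noteq> i \<Longrightarrow> 0 < treat_prob_given d i w j \<and> treat_prob_given d i w j < 1"
  shows "measure_pmf.expectation (design_given d i w)
             (\<lambda>W. theta_hat_minus d i W (obs_outcome Y0 Y1 W))
           = 1 / (real CARD('n) - 1) *
             (\<Sum>j\<in>UNIV - {i}. (1 - treat_prob d j) / treat_prob d j * Y1 j
                - treat_prob d j / (1 - treat_prob d j) * Y0 j)"
proof -
  let ?E = "measure_pmf.expectation (design_given d i w)"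
  let ?q = "treat_prob_given d i w"
  have int: "integrable (measure_pmf (design_given d i w)) g" for g :: "'n assignment \<Rightarrow> real"
    by (rule integrable_measure_pmf_finite) simp
  \<comment> \<open>The coefficients of the two indicators once \<open>W i\<close> is fixed to
    \<open>w\<close>; the indicator of each arm also selects the potential outcome, so no randomness
    is left in \<open>a\<close> and \<open>b\<close>.\<close>
  define a where "a j = Y1 j * (1 - treat_prob d j) / (?q j * treat_prob d j)" for j
  define b where "b j = Y0 j * treat_prob d j / ((1 - ?q j) * (1 - treat_prob d j))" for j
  have "?E (\<lambda>W. theta_hat_minus d i W (obs_outcome Y0 Y1 W))
      = ?E (\<lambda>W. 1 / (real CARD('n) - 1) *
          (\<Sum>j\<in>UNIV - {i}. of_bool (W j) * a j - (1 - of_bool (W j)) * b j))"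
  \<comment> \<open>The integrands agree only where \<open>W i = w\<close>, hence almost everywhere
    under the conditional design.\<close>
  proof (intro integral_cong_AE)
    show "AE W in design_given d i w. theta_hat_minus d i W (obs_outcome Y0 Y1 W)
      = 1 / (real CARD('n) - 1) *
          (\<Sum>j\<in>UNIV - {i}. of_bool (W j) * a j - (1 - of_bool (W j)) * b j)"
    proof (rule AE_pmfI)
      fix W assume "W \<in> set_pmf (design_given d i w)"
      then have "W i = w"
        using \<pi>[of i] by (simp add: set_pmf_design_given)
      then show "theta_hat_minus d i W (obs_outcome Y0 Y1 W)
        = 1 / (real CARD('n) - 1) *
          (\<Sum>j\<in>UNIV - {i}. of_bool (W j) * a j - (1 - of_bool (W j)) * b j)"
        unfolding theta_hat_minus_def right_diff_distrib[symmetric] sum_subtractf[symmetric]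
        by (intro arg_cong2[where f = "(*)"] refl sum.cong)
          (auto simp: obs_outcome_def a_def b_def)
    qed
  qed simp_all
  \<comment> \<open>Each summand is affine in a single indicator, so linearity suffices and
    dependence between units never enters.\<close>
  also have "\<dots> = 1 / (real CARD('n) - 1) * (\<Sum>j\<in>UNIV - {i}. ?q j * a j - (1 - ?q j) * b j)"
    by (simp add: Bochner_Integration.integral_sum Bochner_Integration.integral_diff int
        treat_prob_eq_expectation treat_prob_given_def del: of_bool_eq_iff)
  also have "(\<Sum>j\<in>UNIV - {i}. ?q j * a j - (1 - ?q j) * b j)
      = (\<Sum>j\<in>UNIV - {i}. (1 - treat_prob d j) / treat_prob d j * Y1 j
          - treat_prob d j / (1 - treat_prob d j) * Y0 j)"
  proof (intro sum.cong refl)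
    fix j assume "j \<in> UNIV - {i}"
    \<comment> \<open>Without these, a division by 0 would give 0 and the outcome of that arm would
      be lost instead of recovered.\<close>
    then have "?q j \<noteq> 0" "1 - ?q j \<noteq> 0"
      using given[of j] by auto
    then show "?q j * a j - (1 - ?q j) * b j = (1 - treat_prob d j) / treat_prob d j * Y1 j
        - treat_prob d j / (1 - treat_prob d j) * Y0 j"
      by (simp add: a_def b_def mult.commute)
  qed
  finally show ?thesis .
qed

text \<open>Within an arm the estimator is affine in \<open>\<gamma>\<close> with constant
  coefficients, so \<open>\<gamma>\<close> may depend on the whole assignment: only its two
  conditional means matter.\<close>

lemma expectation_imputation_estimator:
  fixes d :: "('n::finite) design"
  assumes \<pi>: "0 < treat_prob d i" "treat_prob d i < 1"
    and mean: "\<And>w. measure_pmf.expectation (design_given d i w) \<gamma> = m"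
  shows "measure_pmf.expectation d
             (\<lambda>W. imputation_estimator d (\<gamma> W) i W (obs_outcome Y0 Y1 W))
           = (1 - treat_prob d i) * Y1 i + treat_prob d i * Y0 i"
proof -
  let ?p = "treat_prob d i"
  let ?c = "\<lambda>W. imputation_estimator d (\<gamma> W) i W (obs_outcome Y0 Y1 W)"
  have int: "integrable (measure_pmf (design_given d i w)) g"
    for w and g :: "'n assignment \<Rightarrow> real"
    by (rule integrable_measure_pmf_finite) simp
  have "measure_pmf.expectation (design_given d i True) ?c
      = measure_pmf.expectation (design_given d i True) (\<lambda>W. (1 - ?p) / ?p * Y1 i - (1 - ?p) * \<gamma> W)"
    by (intro integral_cong_AE AE_pmfI)
      (auto simp: set_pmf_design_given[OF \<pi>] imputation_estimator_def obs_outcome_def)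
  also have "\<dots> = (1 - ?p) / ?p * Y1 i - (1 - ?p) * m"
    by (simp add: Bochner_Integration.integral_diff int mean)
  finally have treated: "measure_pmf.expectation (design_given d i True) ?c = \<dots>" .
  have "measure_pmf.expectation (design_given d i False) ?c
      = measure_pmf.expectation (design_given d i False) (\<lambda>W. ?p / (1 - ?p) * Y0 i + ?p * \<gamma> W)"
    by (intro integral_cong_AE AE_pmfI)
      (auto simp: set_pmf_design_given[OF \<pi>] imputation_estimator_def obs_outcome_def)
  also have "\<dots> = ?p / (1 - ?p) * Y0 i + ?p * m"
    by (simp add: Bochner_Integration.integral_add int mean)
  finally have control: "measure_pmf.expectation (design_given d i False) ?c = \<dots>" .
  have "?p * ((1 - ?p) / ?p * Y1 i - (1 - ?p) * m) = (1 - ?p) * Y1 i - ?p * (1 - ?p) * m"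
      "(1 - ?p) * (?p / (1 - ?p) * Y0 i + ?p * m) = ?p * Y0 i + ?p * (1 - ?p) * m"
    using \<pi> by (simp_all add: right_diff_distrib distrib_left) (simp add: algebra_simps)
  then show ?thesis
    unfolding total_expectation_design_given[OF \<pi>, of ?c] treated control by linarith
qed

theorem proposition5p8:
  fixes d :: "('n::finite) design"
    and Y0 Y1 :: "'n \<Rightarrow> real"
    and i :: 'n
  defines "\<pi> \<equiv> treat_prob d"
    and "Yobs \<equiv> obs_outcome Y0 Y1"
    and "\<theta> \<equiv> (\<lambda>W. theta_hat_minus d i W (obs_outcome Y0 Y1 W))"
  assumes "\<And>j. 0 < \<pi> j \<and> \<pi> j < 1"
    and "\<And>j w. j \<noteq> i \<Longrightarrow> 0 < treat_prob_given d i w j \<and> treat_prob_given d i w j < 1"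
  shows "measure_pmf.expectation (design_given d i True) \<theta>
           = measure_pmf.expectation (design_given d i False) \<theta>
       \<and> measure_pmf.expectation (design_given d i False) \<theta>
           = 1 / (real CARD('n) - 1) *
             (\<Sum>j\<in>UNIV - {i}. (1 - \<pi> j) / \<pi> j * Y1 j - \<pi> j / (1 - \<pi> j) * Y0 j)
       \<and> measure_pmf.expectation d (\<lambda>W. imputation_estimator d (\<theta> W) i W (Yobs W))
           = (1 - \<pi> i) * Y1 i + \<pi> i * Y0 i"
proof -
  have \<pi>: "0 < treat_prob d j \<and> treat_prob d j < 1" for j
    using assms(4) by (simp add: \<pi>_def)
  \<comment> \<open>For a single unit the factor is 1 / 0 = 0 and the sum is empty, so
    \<open>?m\<close> is 0, as is the estimator.\<close>
  let ?m = "1 / (real CARD('n) - 1) *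
      (\<Sum>j\<in>UNIV - {i}. (1 - \<pi> j) / \<pi> j * Y1 j - \<pi> j / (1 - \<pi> j) * Y0 j)"
  have mean: "measure_pmf.expectation (design_given d i w) \<theta> = ?m" for w
    unfolding \<theta>_def \<pi>_def by (rule expectation_theta_hat_minus[OF \<pi> assms(5)])
  show ?thesis
    using mean[of True] mean[of False]
      expectation_imputation_estimator[of d i \<theta> ?m Y0 Y1, OF _ _ mean] \<pi>[of i]
    by (simp add: \<pi>_def Yobs_def)
qed

end
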